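(* Let $n,N\ge1$ be integers and, for $j=1,\dots,n$, let $c_j\in C^\infty(\mathbb{T}^1;\mathbb{C})$ and let $P_j(D_x)$ be a pseudo-differential operator on $\mathbb{T}^N$ with toroidal symbol $p_j\in S^{m_j}(\mathbb{Z}^N)$, $m_j\in\mathbb{R}$. Let $\mathbb{L}$ be the system on $\mathbb{T}^{n+N}$ given by $L_j=D_{t_j}+c_j(t_j)P_j(D_x)$, $j=1,\dots,n$, and let $c_{j0}=(2\pi)^{-1}\int_0^{2\pi}c_j(s)\,ds$. If $\mathbb{L}$ is globally hypoelliptic, then the set $$\mathcal{Z}=\bigcap_{j=1}^n\{\xi\in\mathbb{Z}^N:\ c_{j0}\,p_j(\xi)\in\mathbb{Z}\}$$ is finite.
   Context: $\mathbb{T}^d=(\mathbb{R}/2\pi\mathbb{Z})^d$ and $D_{t_j}=i^{-1}\partial_{t_j}$. The class $S^{m}(\mathbb{Z}^N)$ of toroidal symbols of order $m$ consists of functions $p:\mathbb{Z}^N\to\mathbb{C}$ such that for every multi-index $\alpha$ there is $C_\alpha>0$ with $|\Delta_\xi^\alpha p(\xi)|\le C_\alpha(1+\|\xi\|)^{m-|\alpha|}$ for all $\xi$, where $\Delta_\xi^\alpha$ are the forward difference operators; in particular $|p(\xi)|\le C(1+\|\xi\|)^m$. The operator with symbol $p$ is $P(D_x)u(x)=\sum_{\xi\in\mathbb{Z}^N}e^{ix\cdot\xi}p(\xi)\widehat{u}(\xi)$, where $\widehat{u}(\xi)$ are the Fourier coefficients; it acts in the $x$ variables on functions and distributions on $\mathbb{T}^{n+N}$.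 A system $L_1,\dots,L_n$ on $\mathbb{T}^{n+N}$ is globally hypoelliptic if the conditions $u\in\mathcal{D}'(\mathbb{T}^{n+N})$ and $L_ju\in C^\infty(\mathbb{T}^{n+N})$ for all $j\in\{1,\dots,n\}$ imply $u\in C^\infty(\mathbb{T}^{n+N})$. *)

theory Defs
  imports "HOL-Analysis.Analysis"
begin

definition partial_deriv :: "'a \<Rightarrow> ('a::euclidean_space \<Rightarrow> complex) \<Rightarrow> 'a \<Rightarrow> complex" where
  "partial_deriv b f = (\<lambda>x. frechet_derivative f (at x) b)"

text \<open>Requiring every iterated partial derivative to be Frechet differentiable makes all of them
  continuous, so this is the usual class of smooth functions.\<close>

definition smooth :: "('a::euclidean_space \<Rightarrow> complex) \<Rightarrow> bool" where
  "smooth f \<longleftrightarrow>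
     (\<forall>bs. set bs \<subseteq> Basis \<longrightarrow> (\<forall>x. foldr partial_deriv bs f differentiable (at x)))"

text \<open>Functions on a torus are functions on the covering Euclidean space that are
  \<open>2\<pi>\<close>-periodic in every coordinate; for \<open>'a = real\<close> this is the one-dimensional torus, and for
  \<open>'a = (real ^ 'n) \<times> (real ^ 'N)\<close> it is the torus of dimension \<open>n + N\<close> with points \<open>(t, x)\<close>.\<close>

definition smooth_torus :: "('a::euclidean_space \<Rightarrow> complex) set" where
  "smooth_torus = {f. smooth f \<and> (\<forall>b\<in>Basis. \<forall>x. f (x + (2 * pi) *\<^sub>R b) = f x)}"

definition torus_cell :: "'a::euclidean_space set" where
  "torus_cell = cbox 0 ((2 * pi) *\<^sub>R One)"

definition Ck_norm :: "nat \<Rightarrow> ('a::euclidean_space \<Rightarrow> complex) \<Rightarrow> real" where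
  "Ck_norm k \<phi> = (\<Sum>bs | set bs \<subseteq> Basis \<and> length bs \<le> k.
     SUP x. cmod (foldr partial_deriv bs \<phi> x))"

text \<open>A distribution is a linear functional on the smooth functions that is continuous for the
  topology of the norms \<open>Ck_norm k\<close>. Its values outside \<open>smooth_torus\<close> are irrelevant.\<close>

type_synonym 'a functional = "('a \<Rightarrow> complex) \<Rightarrow> complex"

definition distributions :: "'a::euclidean_space functional set" where
  "distributions = {u.
     (\<forall>\<phi>\<in>smooth_torus. \<forall>\<psi>\<in>smooth_torus. u (\<lambda>z. \<phi> z + \<psi> z) = u \<phi> + u \<psi>) \<and>
     (\<forall>a. \<forall>\<phi>\<in>smooth_torus. u (\<lambda>z. a * \<phi> z) = a * u \<phi>) \<and>
     (\<exists>C k. \<forall>\<phi>\<in>smooth_torus. cmod (u \<phi>) \<le> C * Ck_norm k \<phi>)}"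

definition is_smooth_distribution :: "'a::euclidean_space functional \<Rightarrow> bool" where
  "is_smooth_distribution u \<longleftrightarrow>
     (\<exists>f\<in>smooth_torus. \<forall>\<phi>\<in>smooth_torus. u \<phi> = integral torus_cell (\<lambda>z. f z * \<phi> z))"

definition D_op :: "'a::euclidean_space \<Rightarrow> 'a functional \<Rightarrow> 'a functional" where
  "D_op b u = (\<lambda>\<phi>. - u (\<lambda>z. inverse \<i> * partial_deriv b \<phi> z))"

definition mult_op :: "('a \<Rightarrow> complex) \<Rightarrow> 'a functional \<Rightarrow> 'a functional" where
  "mult_op g u = (\<lambda>\<phi>. u (\<lambda>z. g z * \<phi> z))"

definition globally_hypoelliptic ::
    "('j \<Rightarrow> 'a::euclidean_space functional \<Rightarrow> 'a functional) \<Rightarrow> bool" where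
  "globally_hypoelliptic L \<longleftrightarrow>
     (\<forall>u\<in>distributions. (\<forall>j. is_smooth_distribution (L j u)) \<longrightarrow> is_smooth_distribution u)"

definition real_vec :: "int ^ 'N \<Rightarrow> real ^ 'N" where
  "real_vec \<xi> = (\<chi> i. real_of_int (\<xi> $ i))"

definition fwd_diff :: "'N \<Rightarrow> (int ^ 'N \<Rightarrow> complex) \<Rightarrow> int ^ 'N \<Rightarrow> complex" where
  "fwd_diff i p = (\<lambda>\<xi>. p (\<xi> + axis i 1) - p \<xi>)"

lemma fwd_diff_commute: "fwd_diff i (fwd_diff j p) = fwd_diff j (fwd_diff i p)"
  by (simp add: fwd_diff_def fun_eq_iff algebra_simps)

text \<open>The composition of the powers \<open>fwd_diff i ^^ (\<alpha> $ i)\<close> over all \<open>i\<close>. The following lemma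
  shows that the order of composition is immaterial, so that \<^const>\<open>Finite_Set.fold\<close> does
  compute it.\<close>

definition diff_op :: "nat ^ 'N \<Rightarrow> (int ^ 'N \<Rightarrow> complex) \<Rightarrow> int ^ 'N \<Rightarrow> complex" where
  "diff_op \<alpha> p = Finite_Set.fold (\<lambda>i. fwd_diff i ^^ (\<alpha> $ i)) p UNIV"

lemma comp_fun_commute_fwd_diff:
  fixes \<alpha> :: "nat ^ 'N"
  shows "comp_fun_commute (\<lambda>i. fwd_diff i ^^ (\<alpha> $ i))"
proof
  fix i j :: 'N
  have "fwd_diff i ((fwd_diff j ^^ k) p) = (fwd_diff j ^^ k) (fwd_diff i p)" for k and p :: "int ^ 'N \<Rightarrow> complex"
    by (induction k) (simp_all add: fwd_diff_commute[of i j])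
  then have "(fwd_diff i ^^ l) ((fwd_diff j ^^ k) p) = (fwd_diff j ^^ k) ((fwd_diff i ^^ l) p)"
    for k l and p :: "int ^ 'N \<Rightarrow> complex"
    by (induction l) simp_all
  then show "fwd_diff j ^^ (\<alpha> $ j) \<circ> fwd_diff i ^^ (\<alpha> $ i)
      = fwd_diff i ^^ (\<alpha> $ i) \<circ> fwd_diff j ^^ (\<alpha> $ j)"
    by (simp add: fun_eq_iff)
qed

definition toroidal_symbols :: "real \<Rightarrow> (int ^ 'N \<Rightarrow> complex) set" where
  "toroidal_symbols m = {p. \<forall>\<alpha>. \<exists>C>0. \<forall>\<xi>.
     cmod (diff_op \<alpha> p \<xi>) \<le> C * (1 + norm (real_vec \<xi>)) powr (m - real (\<Sum>i\<in>UNIV. \<alpha> $ i))}"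

text \<open>\<open>fourier_coeff_x u \<xi>\<close> is the partial Fourier coefficient of \<open>u\<close> in the variable \<open>x\<close>, a
  distribution in \<open>t\<close>.\<close>

definition fourier_coeff_x ::
    "((real ^ 'n) \<times> (real ^ 'N)) functional \<Rightarrow> int ^ 'N \<Rightarrow> (real ^ 'n) functional" where
  "fourier_coeff_x u \<xi> = (\<lambda>\<psi>.
     complex_of_real (1 / (2 * pi) ^ CARD('N)) * u (\<lambda>(t, x). \<psi> t * cis (- (x \<bullet> real_vec \<xi>))))"

text \<open>The series \<open>\<Sum>\<xi>. exp (\<i> x\<cdot>\<xi>) p(\<xi>) u^(t, \<xi>)\<close>, summed weakly: the term of index \<open>\<xi>\<close> acts on a
  test function \<open>\<phi>\<close> by first integrating \<open>exp (\<i> x\<cdot>\<xi>) \<phi>(t, x)\<close> over \<open>x\<close> and then applying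
  \<open>p(\<xi>) u^(-, \<xi>)\<close> in \<open>t\<close>.\<close>

definition psd_op :: "(int ^ 'N \<Rightarrow> complex)
    \<Rightarrow> ((real ^ 'n) \<times> (real ^ 'N)) functional \<Rightarrow> ((real ^ 'n) \<times> (real ^ 'N)) functional" where
  "psd_op p u = (\<lambda>\<phi>. \<Sum>\<^sub>\<infinity>\<xi>\<in>UNIV. p \<xi> *
     fourier_coeff_x u \<xi> (\<lambda>t. integral torus_cell (\<lambda>x. cis (x \<bullet> real_vec \<xi>) * \<phi> (t, x))))"

definition system_op :: "('n \<Rightarrow> real \<Rightarrow> complex) \<Rightarrow> ('n \<Rightarrow> int ^ 'N \<Rightarrow> complex) \<Rightarrow> 'n
    \<Rightarrow> ((real ^ 'n) \<times> (real ^ 'N)) functional \<Rightarrow> ((real ^ 'n) \<times> (real ^ 'N)) functional" where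
  "system_op c p j u = (\<lambda>\<phi>.
     D_op (axis j 1, 0) u \<phi> + mult_op (\<lambda>(t, x). c j (t $ j)) (psd_op (p j) u) \<phi>)"

definition mean_value :: "(real \<Rightarrow> complex) \<Rightarrow> complex" where
  "mean_value g = complex_of_real (1 / (2 * pi)) * integral {0..2 * pi} g"

end

theory Submission
  imports Defs
begin

text \<open>
  Suppose that infinitely many frequencies \<open>\<xi>\<close> are resonant, that is, \<open>c\<^sub>j\<^sub>0 p\<^sub>j(\<xi>)\<close> is an integer for all
  \<open>j\<close>. For each of them the system restricted to the frequency \<open>\<xi>\<close> is a system of ordinary differential
  equations in separate variables, and resonance says that its solution
  \<open>exp (- \<i> \<Sum>j. p\<^sub>j(\<xi>) C\<^sub>j(t\<^sub>j))\<close>, with \<open>C\<^sub>j' = c\<^sub>j\<close>, is periodic. Multiplied by \<open>exp (\<i> x\<cdot>\<xi>)\<close> and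
  normalised in \<open>L\<^sup>2\<close>, it gives a smooth mode \<open>E\<^sub>\<xi>\<close> on the torus that all operators of the system
  annihilate (\<open>homogeneous_solution\<close>).

  The sum \<open>u\<close> of infinitely many such modes is a distribution, because the coefficients \<open>\<integral> E\<^sub>\<xi> \<phi>\<close> of a smooth
  \<open>\<phi>\<close> decay rapidly in \<open>\<xi>\<close> (\<open>mode_sum_distribution\<close>). Each \<open>L\<^sub>j\<close> maps \<open>u\<close> to zero, by cancellation in every
  mode (\<open>system_op_mode_sum_zero\<close>). But \<open>u\<close> is not smooth: its pairing with the conjugate of each
  \<open>E\<^sub>\<xi>\<close> is \<open>1\<close> by orthonormality, whereas for a smooth function these pairings tend to zero
  (\<open>mode_sum_not_smooth\<close>). So the system is not globally hypoelliptic.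

  The functions \<open>C\<^sub>j\<close> are complex, so a mode may vary over many orders of magnitude in \<open>t\<close>; normalising in
  \<open>L\<^sup>2\<close> fixes its pairing with its own conjugate and bounds its \<open>L\<^sup>1\<close> norm at the same time. Passing to a sequence of frequencies that grows strictly in one
  coordinate \<open>x\<^sub>i\<close> reduces decay and orthogonality to integration by parts in the
  variable \<open>x\<^sub>i\<close>, which in turn rests on the vanishing of the integral of a derivative over the torus
  (\<open>integral_partial_deriv_zero\<close>).
\<close>

section \<open>Smooth functions\<close>

lemma smooth_imp_differentiable: "smooth f \<Longrightarrow> f differentiable (at x)"
  unfolding smooth_def by (drule spec[of _ "[]"]) simp

lemma smooth_foldr:
  assumes "smooth f" "set bs \<subseteq> Basis"
  shows "smooth (foldr partial_deriv bs f)"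
  unfolding smooth_def
proof (intro allI impI)
  fix cs x assume "set cs \<subseteq> (Basis :: 'a set)"
  with assms have "foldr partial_deriv (cs @ bs) f differentiable (at x)"
    unfolding smooth_def by (metis set_append Un_subset_iff)
  then show "foldr partial_deriv cs (foldr partial_deriv bs f) differentiable (at x)" by simp
qed

lemma smooth_partial_deriv: "smooth f \<Longrightarrow> b \<in> Basis \<Longrightarrow> smooth (partial_deriv b f)"
  using smooth_foldr[of f "[b]"] by simp

lemma smooth_continuous: "smooth f \<Longrightarrow> continuous_on S f"
  by (meson smooth_imp_differentiable differentiable_imp_continuous_within
      continuous_at_imp_continuous_on)

lemma partial_deriv_eqI: "(f has_derivative f') (at x) \<Longrightarrow> partial_deriv b f x = f' b"
  unfolding partial_deriv_def using frechet_derivative_at by metis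

lemma partial_deriv_mult:
  assumes "f differentiable (at x)" "g differentiable (at x)"
  shows "partial_deriv b (\<lambda>x. f x * g x) x = partial_deriv b f x * g x + f x * partial_deriv b g x"
  using has_derivative_mult[OF assms[unfolded frechet_derivative_works]]
  by (subst partial_deriv_eqI) (auto simp: partial_deriv_def algebra_simps)

text \<open>Smoothness of a function is proved below by exhibiting generators whose partial derivatives are
  polynomials in the generators: the algebra that they generate is then stable under differentiation
  and made of differentiable functions, so all its members are smooth. In this way no formula for
  higher derivatives of products or compositions is needed.\<close>

inductive_set function_algebra :: "('a \<Rightarrow> complex) set \<Rightarrow> ('a \<Rightarrow> complex) set" for G where
  gen: "g \<in> G \<Longrightarrow> g \<in> function_algebra G"
| const: "(\<lambda>_. c) \<in> function_algebra G"
| add: "f \<in> function_algebra G \<Longrightarrow> g \<in> function_algebra G \<Longrightarrow> (\<lambda>x. f x + g x) \<in> function_algebra G"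
| mult: "f \<in> function_algebra G \<Longrightarrow> g \<in> function_algebra G \<Longrightarrow> (\<lambda>x. f x * g x) \<in> function_algebra G"

lemma smooth_function_algebra:
  fixes G :: "('a::euclidean_space \<Rightarrow> complex) set"
  assumes diff: "\<And>g x. g \<in> G \<Longrightarrow> g differentiable (at x)"
    and closed: "\<And>g b. g \<in> G \<Longrightarrow> b \<in> Basis \<Longrightarrow> partial_deriv b g \<in> function_algebra G"
    and f: "f \<in> function_algebra G"
  shows "smooth f"
proof -
  have *: "(\<forall>x. f differentiable (at x)) \<and> (\<forall>b\<in>Basis. partial_deriv b f \<in> function_algebra G)"
    if "f \<in> function_algebra G" for f
    using that
  proof (induction rule: function_algebra.induct)
    case (gen g)
    then show ?case using diff closed by auto
  next
    case (const c)
    have "partial_deriv b (\<lambda>_. c) = (\<lambda>_. 0)" for b :: 'a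
      by (simp add: fun_eq_iff partial_deriv_def)
    then show ?case by (simp add: function_algebra.const)
  next
    case (add f g)
    have "partial_deriv b (\<lambda>x. f x + g x) = (\<lambda>x. partial_deriv b f x + partial_deriv b g x)" for b
      using add by (intro ext partial_deriv_eqI[THEN trans])
        (auto simp: partial_deriv_def frechet_derivative_works intro!: derivative_eq_intros)
    then show ?case using add by (auto intro: function_algebra.add)
  next
    case (mult f g)
    have "partial_deriv b (\<lambda>x. f x * g x)
        = (\<lambda>x. partial_deriv b f x * g x + f x * partial_deriv b g x)" for b
      using mult by (intro ext partial_deriv_mult) auto
    then show ?case
      using mult by (auto intro!: function_algebra.add[OF function_algebra.mult function_algebra.mult])
  qed
  have "foldr partial_deriv bs f \<in> function_algebra G" if "set bs \<subseteq> Basis" for bs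
    using that by (induction bs) (use f * in auto)
  then show ?thesis unfolding smooth_def using * by blast
qed

lemma smooth_closure:
  assumes "f \<in> function_algebra {f. smooth f}"
  shows "smooth (f :: 'a::euclidean_space \<Rightarrow> complex)"
  by (rule smooth_function_algebra[OF _ _ assms])
    (auto intro: smooth_imp_differentiable smooth_partial_deriv function_algebra.gen)

lemma smooth_const: "smooth (\<lambda>_ :: 'a::euclidean_space. c)"
  by (intro smooth_closure function_algebra.const)

lemma smooth_mult: "smooth f \<Longrightarrow> smooth g \<Longrightarrow> smooth (\<lambda>x. f x * g x)"
  by (intro smooth_closure function_algebra.mult function_algebra.gen) auto

lemma smooth_add: "smooth f \<Longrightarrow> smooth g \<Longrightarrow> smooth (\<lambda>x. f x + g x)"
  by (intro smooth_closure function_algebra.add function_algebra.gen) auto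

lemma smooth_sum:
  "(\<And>i. i \<in> A \<Longrightarrow> smooth (f i)) \<Longrightarrow> smooth (\<lambda>x :: 'a::euclidean_space. \<Sum>i\<in>A. f i x)"
  by (induction A rule: infinite_finite_induct) (auto intro: smooth_add smooth_const)

text \<open>Every derivative of \<open>E\<close> is a smooth multiple of \<open>E\<close>, so \<open>E\<close> and the smooth functions generate an
  algebra stable under differentiation. This covers exponentials of smooth phases.\<close>

lemma smooth_log_derivative:
  fixes E :: "'a::euclidean_space \<Rightarrow> complex"
  assumes diff: "\<And>x. E differentiable (at x)"
    and g: "\<And>b. b \<in> Basis \<Longrightarrow> smooth (g b)"
    and pd: "\<And>b x. b \<in> Basis \<Longrightarrow> partial_deriv b E x = g b x * E x"
  shows "smooth E"
proof (rule smooth_function_algebra[where G = "insert E {f. smooth f}"])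
  fix h :: "'a \<Rightarrow> complex" and b :: 'a assume h: "h \<in> insert E {f. smooth f}" and b: "b \<in> Basis"
  have "partial_deriv b E = (\<lambda>x. g b x * E x)" using pd b by auto
  moreover have "(\<lambda>x. g b x * E x) \<in> function_algebra (insert E {f. smooth f})"
    by (intro function_algebra.mult function_algebra.gen) (use g b in auto)
  ultimately show "partial_deriv b h \<in> function_algebra (insert E {f. smooth f})"
    using h b by (auto intro: function_algebra.gen smooth_partial_deriv)
qed (auto intro: diff smooth_imp_differentiable function_algebra.gen)

lemma partial_deriv_cnj:
  assumes "f differentiable (at x)"
  shows "partial_deriv b (\<lambda>x. cnj (f x)) x = cnj (partial_deriv b f x)"
  using assms unfolding frechet_derivative_works
  by (subst partial_deriv_eqI[OF has_derivative_cnj]) (auto simp: partial_deriv_def)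

lemma smooth_cnj:
  assumes "smooth f"
  shows "smooth (\<lambda>x. cnj (f x))"
proof (rule smooth_function_algebra[where G = "{\<lambda>x. cnj (f x) |f. smooth f}"])
  fix g x assume "g \<in> {\<lambda>x::'a. cnj (f x) |f. smooth f}"
  then obtain f where f: "g = (\<lambda>x. cnj (f x))" "smooth f" by auto
  then show "g differentiable (at x)"
    unfolding f by (metis smooth_imp_differentiable differentiable_def has_derivative_cnj)
  fix b :: 'a assume "b \<in> Basis"
  with f show "partial_deriv b g \<in> function_algebra {\<lambda>x::'a. cnj (f x) |f. smooth f}"
    unfolding f
    by (intro function_algebra.gen CollectI exI[of _ "partial_deriv b f"] conjI)
      (auto simp: fun_eq_iff partial_deriv_cnj smooth_imp_differentiable smooth_partial_deriv)
qed (use assms in \<open>auto intro: function_algebra.gen\<close>)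

lemma has_derivative_coordinate:
  fixes f :: "real \<Rightarrow> complex"
  assumes "f differentiable (at (z \<bullet> a))"
  shows "((\<lambda>z. f (z \<bullet> a)) has_derivative (\<lambda>h. of_real (h \<bullet> a) * partial_deriv 1 f (z \<bullet> a))) (at z)"
proof -
  have f: "(f has_derivative frechet_derivative f (at (z \<bullet> a))) (at (z \<bullet> a))"
    using assms by (simp add: frechet_derivative_works)
  have "((\<lambda>z. f (z \<bullet> a)) has_derivative (\<lambda>h. frechet_derivative f (at (z \<bullet> a)) (h \<bullet> a))) (at z)"
    by (rule has_derivative_compose[where g = f and f = "\<lambda>z. z \<bullet> a", OF _ f]) (auto intro!: derivative_eq_intros)
  moreover have "frechet_derivative f (at (z \<bullet> a)) s = of_real s * partial_deriv 1 f (z \<bullet> a)" for s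
    using linear_scale[OF has_derivative_linear[OF f], of s 1]
    by (simp add: partial_deriv_def scaleR_conv_of_real)
  ultimately show ?thesis by simp
qed

lemma smooth_coordinate:
  fixes f :: "real \<Rightarrow> complex" and a :: "'a::euclidean_space"
  assumes "smooth f"
  shows "smooth (\<lambda>z. f (z \<bullet> a))"
proof (rule smooth_function_algebra[where G = "{\<lambda>z. f (z \<bullet> a) |f. smooth f}"])
  fix g x assume "g \<in> {\<lambda>z. f (z \<bullet> a) |f. smooth f}"
  then obtain f where f: "g = (\<lambda>z. f (z \<bullet> a))" "smooth f" by auto
  note der = has_derivative_coordinate[OF smooth_imp_differentiable[OF f(2)]]
  show "g differentiable (at x)"
    unfolding f differentiable_def using der by blast
  fix b :: 'a assume "b \<in> Basis"
  have "partial_deriv b g = (\<lambda>z. of_real (b \<bullet> a) * partial_deriv 1 f (z \<bullet> a))"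
    unfolding f by (rule ext) (rule partial_deriv_eqI[OF der])
  moreover have "smooth (partial_deriv 1 f)"
    by (intro smooth_partial_deriv f) simp
  ultimately show "partial_deriv b g \<in> function_algebra {\<lambda>z. f (z \<bullet> a) |f. smooth f}"
    by (simp only:) (intro function_algebra.mult function_algebra.const function_algebra.gen, auto)
qed (use assms in \<open>auto intro: function_algebra.gen\<close>)

section \<open>Functions on the torus\<close>

lemma smooth_torusD:
  assumes "f \<in> smooth_torus"
  shows "smooth f" "b \<in> Basis \<Longrightarrow> f (x + (2 * pi) *\<^sub>R b) = f x"
  using assms by (auto simp: smooth_torus_def)

lemma smooth_torus_const: "(\<lambda>_. c) \<in> smooth_torus"
  by (simp add: smooth_torus_def smooth_const)

lemma smooth_torus_mult:
  "f \<in> smooth_torus \<Longrightarrow> g \<in> smooth_torus \<Longrightarrow> (\<lambda>x. f x * g x) \<in> smooth_torus"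
  by (simp add: smooth_torus_def smooth_mult)

lemma smooth_torus_cnj: "f \<in> smooth_torus \<Longrightarrow> (\<lambda>x. cnj (f x)) \<in> smooth_torus"
  by (simp add: smooth_torus_def smooth_cnj)

lemma smooth_torus_partial_deriv:
  assumes "f \<in> smooth_torus" "b \<in> Basis"
  shows "partial_deriv b f \<in> smooth_torus"
proof -
  have "partial_deriv b f (x + (2 * pi) *\<^sub>R a) = partial_deriv b f x" if "a \<in> Basis" for a x
  proof -
    let ?y = "x + (2 * pi) *\<^sub>R a"
    have f: "(f has_derivative frechet_derivative f (at ?y)) (at ?y)"
      using smooth_imp_differentiable[OF smooth_torusD(1)[OF assms(1)]]
      by (simp add: frechet_derivative_works)
    have "((\<lambda>x. f (x + (2 * pi) *\<^sub>R a)) has_derivative frechet_derivative f (at ?y)) (at x)"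
      by (rule has_derivative_compose[where g = f and f = "\<lambda>x. x + (2 * pi) *\<^sub>R a", OF _ f, THEN has_derivative_eq_rhs])
        (auto intro!: derivative_eq_intros)
    then show ?thesis
      using smooth_torusD(2)[OF assms(1) that]
      by (simp add: partial_deriv_eqI) (simp add: partial_deriv_def)
  qed
  then show ?thesis
    using assms by (auto simp: smooth_torus_def smooth_partial_deriv)
qed

lemma smooth_torus_continuous: "f \<in> smooth_torus \<Longrightarrow> continuous_on S f"
  by (intro smooth_continuous smooth_torusD)

lemma smooth_torus_integrable: "f \<in> smooth_torus \<Longrightarrow> f integrable_on torus_cell"
  unfolding torus_cell_def by (intro integrable_continuous smooth_torus_continuous)

lemma inner_One: "b \<in> Basis \<Longrightarrow> One \<bullet> b = 1"
  by (simp add: inner_sum_left_Basis)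

lemma mem_torus_cell: "x \<in> torus_cell \<longleftrightarrow> (\<forall>b\<in>Basis. 0 \<le> x \<bullet> b \<and> x \<bullet> b \<le> 2 * pi)"
  unfolding torus_cell_def mem_box by (simp add: inner_One)

lemma periodic_shift_int:
  assumes f: "\<And>x. f (x + c) = f x"
  shows "f (x + of_int k *\<^sub>R c) = f (x :: 'a::real_vector)"
proof -
  have nat: "f (x + of_nat n *\<^sub>R c) = f x" for x and n :: nat
  proof (induction n)
    case (Suc n)
    then show ?case using f[of "x + of_nat n *\<^sub>R c"] by (simp add: algebra_simps)
  qed simp
  show ?thesis
  proof (cases k)
    case (nonneg n)
    then show ?thesis using nat by simp
  next
    case (neg n)
    then have "of_int k + of_nat (Suc n) = (0 :: real)" by simp
    then have "x + of_int k *\<^sub>R c + of_nat (Suc n) *\<^sub>R c = x"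
      by (metis add.assoc add.right_neutral scaleR_left_distrib scaleR_zero_left)
    then show ?thesis using nat[of "x + of_int k *\<^sub>R c" "Suc n"] by metis
  qed
qed

lemma torus_representative:
  fixes x :: "'a::euclidean_space"
  obtains y where "y \<in> torus_cell" "\<And>f. f \<in> smooth_torus \<Longrightarrow> f x = f y"
proof
  have two_pi: "0 < 2 * pi" by simp
  define k where "k b = \<lfloor>x \<bullet> b / (2 * pi)\<rfloor>" for b
  let ?y = "x - (\<Sum>b\<in>Basis. of_int (k b) *\<^sub>R (2 * pi) *\<^sub>R b)"
  have "?y \<bullet> b = x \<bullet> b - of_int (k b) * (2 * pi)" if "b \<in> Basis" for b
    using that by (simp add: inner_diff_left inner_sum_left inner_Basis if_distrib cong: if_cong)
  moreover have "of_int (k b) * (2 * pi) \<le> x \<bullet> b" for b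
    using of_int_floor_le[of "x \<bullet> b / (2 * pi)"] unfolding k_def pos_le_divide_eq[OF two_pi] .
  moreover have "x \<bullet> b \<le> (of_int (k b) + 1) * (2 * pi)" for b
    using floor_correct[of "x \<bullet> b / (2 * pi)"]
    unfolding k_def pos_divide_less_eq[OF two_pi] of_int_add of_int_1 by linarith
  ultimately show "?y \<in> torus_cell"
    unfolding mem_torus_cell by (auto simp: algebra_simps)
  fix f :: "'a \<Rightarrow> complex" assume f: "f \<in> smooth_torus"
  have "f (z - (\<Sum>b\<in>A. of_int (k b) *\<^sub>R (2 * pi) *\<^sub>R b)) = f z" if "finite A" "A \<subseteq> Basis" for A z
    using that
  proof (induction A arbitrary: z)
    case (insert b A)
    let ?s = "\<Sum>b\<in>A. of_int (k b) *\<^sub>R (2 * pi) *\<^sub>R b"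
    have "f (z - ?s + of_int (- k b) *\<^sub>R (2 * pi) *\<^sub>R b) = f (z - ?s)"
      by (rule periodic_shift_int) (use insert f in \<open>auto intro: smooth_torusD\<close>)
    then show ?case using insert by (simp add: algebra_simps)
  qed simp
  then show "f x = f ?y" by simp
qed

lemma smooth_torus_bounded:
  assumes "f \<in> smooth_torus"
  shows "bdd_above (range (\<lambda>x. cmod (f x)))"
proof -
  have "compact ((\<lambda>x. cmod (f x)) ` torus_cell)"
    unfolding torus_cell_def
    by (intro compact_continuous_image continuous_intros smooth_torus_continuous assms) auto
  then have "bdd_above ((\<lambda>x. cmod (f x)) ` torus_cell)"
    by (simp add: bounded_imp_bdd_above compact_imp_bounded)
  moreover have "range (\<lambda>x. cmod (f x)) \<subseteq> (\<lambda>x. cmod (f x)) ` torus_cell"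
  proof clarify
    fix x
    obtain y where "y \<in> torus_cell" "f x = f y"
      using torus_representative[of x] assms by metis
    then show "cmod (f x) \<in> (\<lambda>x. cmod (f x)) ` torus_cell" by auto
  qed
  ultimately show ?thesis by (rule bdd_above_mono)
qed

lemma smooth_torus_foldr:
  assumes "f \<in> smooth_torus" "set bs \<subseteq> Basis"
  shows "foldr partial_deriv bs f \<in> smooth_torus"
  using assms(2) by (induction bs) (use assms smooth_torus_partial_deriv in auto)

lemma partial_derivs_le_Ck_norm:
  fixes f :: "'a::euclidean_space \<Rightarrow> complex"
  assumes f: "f \<in> smooth_torus" and bs: "set bs \<subseteq> Basis" "length bs \<le> k"
  shows "cmod (foldr partial_deriv bs f x) \<le> Ck_norm k f"
proof -
  let ?S = "{bs. set bs \<subseteq> (Basis :: 'a set) \<and> length bs \<le> k}"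
  have le: "cmod (foldr partial_deriv cs f y) \<le> (SUP x. cmod (foldr partial_deriv cs f x))"
    if "cs \<in> ?S" for cs y
    using that f by (intro cSUP_upper smooth_torus_bounded smooth_torus_foldr) auto
  have "cmod (foldr partial_deriv bs f x) \<le> (SUP x. cmod (foldr partial_deriv bs f x))"
    using le bs by auto
  also have "\<dots> \<le> Ck_norm k f"
    unfolding Ck_norm_def
  proof (rule member_le_sum)
    show "finite ?S" by (rule finite_lists_length_le) simp
    show "0 \<le> (SUP x. cmod (foldr partial_deriv cs f x))" if "cs \<in> ?S - {bs}" for cs
      using le[of cs 0] that by (auto intro: order_trans[OF norm_ge_zero])
  qed (use bs in auto)
  finally show ?thesis .
qed

lemma Ck_norm_nonneg: "f \<in> smooth_torus \<Longrightarrow> 0 \<le> Ck_norm k f"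
  using partial_derivs_le_Ck_norm[of f "[]" k 0] by (auto intro: order_trans[OF norm_ge_zero])

section \<open>Integration by parts on the torus\<close>

text \<open>The shifted cell exceeds the hyperplane at \<open>2\<pi>\<close> orthogonal to \<open>b\<close> by a slab; moving this slab
  back by one period fills the gap that the shift has left in the cell.\<close>

lemma integral_torus_shift:
  fixes f :: "'a::euclidean_space \<Rightarrow> complex"
  assumes f: "continuous_on UNIV f" "\<And>x. f (x + (2 * pi) *\<^sub>R b) = f x"
    and b: "b \<in> Basis" and s: "0 \<le> s" "s \<le> 2 * pi"
  shows "integral torus_cell (\<lambda>x. f (x + s *\<^sub>R b)) = integral torus_cell f"
proof -
  let ?p = "(2 * pi) *\<^sub>R b" and ?T = "(2 * pi) *\<^sub>R One :: 'a"
  let ?L = "cbox 0 ?T \<inter> {x. x \<bullet> b \<le> s}" and ?R = "cbox 0 ?T \<inter> {x. x \<bullet> b \<ge> s}"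
  let ?B = "cbox (s *\<^sub>R b) (?T + s *\<^sub>R b)"
  have int: "f integrable_on cbox u v" for u v
    by (intro integrable_continuous continuous_on_subset[OF f(1)]) auto
  \<comment> \<open>The condition for membership in the cell on the coordinates that the shift leaves fixed.\<close>
  define Q where "Q x \<longleftrightarrow> (\<forall>i\<in>Basis - {b}. 0 \<le> x \<bullet> i \<and> x \<bullet> i \<le> 2 * pi)" for x :: 'a
  have bb: "b \<bullet> i = 0" if "i \<in> Basis - {b}" for i
    using b that by (auto simp: inner_Basis)
  have b1: "b \<bullet> b = 1" using b by simp
  have split: "(\<forall>i\<in>Basis. P i) \<longleftrightarrow> P b \<and> (\<forall>i\<in>Basis - {b}. P i)" for P
    using b by auto
  have cell: "x \<in> cbox 0 ?T \<longleftrightarrow> 0 \<le> x \<bullet> b \<and> x \<bullet> b \<le> 2 * pi \<and> Q x" for x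
    unfolding Q_def mem_box split[of "\<lambda>i. _ i \<and> _ i"] using b by (simp add: inner_One)
  have B: "x \<in> ?B \<longleftrightarrow> s \<le> x \<bullet> b \<and> x \<bullet> b \<le> 2 * pi + s \<and> Q x" for x
    unfolding Q_def mem_box split[of "\<lambda>i. _ i \<and> _ i"] using b by (simp add: inner_One inner_add_left bb b1)
  have Q: "Q (x + r *\<^sub>R b) \<longleftrightarrow> Q x" for x r
    unfolding Q_def by (simp add: inner_add_left bb)
  obtain u v where uv: "?L = cbox u v"
    using interval_split(1)[OF b, of 0 ?T s] by blast
  have low: "?B \<inter> {x. x \<bullet> b \<le> 2 * pi} = ?R"
    using s by (auto simp: B cell)
  have "?B \<inter> {x. x \<bullet> b \<ge> 2 * pi} = (\<lambda>x. x + ?p) ` ?L"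
  proof (intro equalityI subsetI)
    fix x assume "x \<in> ?B \<inter> {x. x \<bullet> b \<ge> 2 * pi}"
    then have x: "2 * pi \<le> x \<bullet> b" "x \<bullet> b \<le> 2 * pi + s" "Q x"
      unfolding Int_iff B mem_Collect_eq by blast+
    have "(x - ?p) \<bullet> b = x \<bullet> b - 2 * pi" "Q (x - ?p)"
      using Q[of "x - ?p" "2 * pi"] x(3) by (simp_all add: inner_diff_left b1)
    then have "x - ?p \<in> ?L"
      unfolding Int_iff cell mem_Collect_eq using x s by linarith
    then show "x \<in> (\<lambda>x. x + ?p) ` ?L" by (rule rev_image_eqI) (rule diff_add_cancel[symmetric])
  next
    fix y assume "y \<in> (\<lambda>x. x + ?p) ` ?L"
    then obtain x where y: "y = x + ?p" and "x \<in> ?L" by blast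
    then have x: "0 \<le> x \<bullet> b" "x \<bullet> b \<le> s" "Q x"
      unfolding Int_iff cell mem_Collect_eq by blast+
    have "y \<bullet> b = x \<bullet> b + 2 * pi" "Q y"
      unfolding y using Q x(3) by (simp_all add: inner_add_left b1)
    then show "y \<in> ?B \<inter> {x. x \<bullet> b \<ge> 2 * pi}"
      unfolding Int_iff B mem_Collect_eq using x s by linarith
  qed
  also have "\<dots> = cbox (u + ?p) (v + ?p)"
    unfolding uv using cbox_translation[of ?p u v] by (simp add: add.commute)
  finally have high: "?B \<inter> {x. x \<bullet> b \<ge> 2 * pi} = cbox (u + ?p) (v + ?p)" .
  have "integral torus_cell (\<lambda>x. f (x + s *\<^sub>R b)) = integral ?B f"
    unfolding torus_cell_def
    using integral_shift_cbox_plus[of 0 ?T f "s *\<^sub>R b"] by (simp add: o_def add.commute)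
  also have "\<dots> = integral ?R f + integral (cbox (u + ?p) (v + ?p)) f"
    using integral_split[OF int b, of "s *\<^sub>R b" "?T + s *\<^sub>R b" "2 * pi"] low high by simp
  also have "integral (cbox (u + ?p) (v + ?p)) f = integral ?L f"
    unfolding uv using integral_shift_cbox_plus[of u v f ?p] f(2)
    by (simp add: o_def add.commute)
  also have "integral ?R f + integral ?L f = integral torus_cell f"
    unfolding torus_cell_def using integral_split[OF int b, of 0 ?T s] by simp
  finally show ?thesis .
qed

text \<open>Differentiate the integral over the cell, which does not depend on a translation in the
  direction \<open>b\<close>, with respect to that translation.\<close>

lemma integral_partial_deriv_zero:
  fixes f :: "'a::euclidean_space \<Rightarrow> complex"
  assumes f: "f \<in> smooth_torus" and b: "b \<in> Basis"
  shows "integral torus_cell (partial_deriv b f) = 0"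
proof -
  note df = smooth_torus_partial_deriv[OF f b]
  have line: "((\<lambda>s. f (z + s *\<^sub>R b)) has_vector_derivative partial_deriv b f (z + s *\<^sub>R b))
      (at s within S)" for z s S
  proof -
    let ?F = "frechet_derivative f (at (z + s *\<^sub>R b))"
    have F: "(f has_derivative ?F) (at (z + s *\<^sub>R b))"
      using smooth_imp_differentiable[OF smooth_torusD(1)[OF f]] by (simp add: frechet_derivative_works)
    have "((\<lambda>s. f (z + s *\<^sub>R b)) has_derivative (\<lambda>h. ?F (h *\<^sub>R b))) (at s within S)"
      by (rule has_derivative_compose[where g = f and f = "\<lambda>s. z + s *\<^sub>R b", OF _ F]) (auto intro!: derivative_eq_intros)
    then show ?thesis
      unfolding has_vector_derivative_def partial_deriv_def
      by (simp add: linear_scale[OF has_derivative_linear[OF F]])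
  qed
  have "((\<lambda>s. integral torus_cell (\<lambda>z. f (z + s *\<^sub>R b))) has_vector_derivative
      integral torus_cell (\<lambda>z. partial_deriv b f (z + 0 *\<^sub>R b))) (at 0 within {0..1})"
    unfolding torus_cell_def
  proof (rule leibniz_rule_vector_derivative)
    show "continuous_on ({0..1} \<times> cbox 0 ((2 * pi) *\<^sub>R One))
        (\<lambda>(s, z). partial_deriv b f (z + s *\<^sub>R b))"
      unfolding split_beta
      by (intro continuous_on_compose2[OF smooth_torus_continuous[OF df, of UNIV]] continuous_intros) auto
    show "(\<lambda>z. f (z + s *\<^sub>R b)) integrable_on cbox 0 ((2 * pi) *\<^sub>R One)" for s
      by (intro integrable_continuous continuous_on_compose2[OF smooth_torus_continuous[OF f, of UNIV]]
          continuous_intros) auto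
  qed (use line in auto)
  moreover have "((\<lambda>s. integral torus_cell (\<lambda>z. f (z + s *\<^sub>R b))) has_vector_derivative 0)
      (at 0 within {0..1})"
    by (rule has_vector_derivative_transform[OF _ _ has_vector_derivative_const[of "integral torus_cell f"]])
      (use integral_torus_shift[OF smooth_torus_continuous[OF f] smooth_torusD(2)[OF f b] b] pi_ge_two
        in auto)
  ultimately show ?thesis
    using vector_derivative_unique_within_closed_interval[of 0 1 0] by simp
qed

lemma integral_torus_by_parts:
  assumes f: "f \<in> smooth_torus" and g: "g \<in> smooth_torus" and b: "b \<in> Basis"
  shows "integral torus_cell (\<lambda>x. partial_deriv b f x * g x)
       = - integral torus_cell (\<lambda>x. f x * partial_deriv b g x)"
proof -
  have "partial_deriv b (\<lambda>x. f x * g x) = (\<lambda>x. partial_deriv b f x * g x + f x * partial_deriv b g x)"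
    using f g by (intro ext partial_deriv_mult smooth_imp_differentiable smooth_torusD)
  then have "0 = integral torus_cell (\<lambda>x. partial_deriv b f x * g x + f x * partial_deriv b g x)"
    using integral_partial_deriv_zero[OF smooth_torus_mult[OF f g] b] by simp
  also have "\<dots> = integral torus_cell (\<lambda>x. partial_deriv b f x * g x)
      + integral torus_cell (\<lambda>x. f x * partial_deriv b g x)"
    using f g b by (intro Henstock_Kurzweil_Integration.integral_add smooth_torus_integrable smooth_torus_mult smooth_torus_partial_deriv)
  finally show ?thesis by (simp add: eq_neg_iff_add_eq_0)
qed

section \<open>Distributions given by sums of modes\<close>

definition mode_sum :: "(nat \<Rightarrow> 'a \<Rightarrow> complex) \<Rightarrow> 'a::euclidean_space functional" where
  "mode_sum E = (\<lambda>\<phi>. \<Sum>\<^sub>\<infinity>k. integral torus_cell (\<lambda>z. E k z * \<phi> z))"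

lemma integral_mode_partial_deriv:
  assumes "E \<in> smooth_torus" "\<phi> \<in> smooth_torus" "b \<in> Basis"
    and pd: "\<And>z. partial_deriv b E z = \<i> * of_int a * E z"
  shows "integral torus_cell (\<lambda>z. E z * partial_deriv b \<phi> z)
    = - \<i> * of_int a * integral torus_cell (\<lambda>z. E z * \<phi> z)"
proof -
  have "integral torus_cell (\<lambda>z. E z * partial_deriv b \<phi> z)
      = - integral torus_cell (\<lambda>z. (\<i> * of_int a) * (E z * \<phi> z))"
    using integral_torus_by_parts[OF assms(1-3)] by (simp add: pd mult.assoc)
  then show ?thesis by simp
qed

text \<open>Two integrations by parts in a direction in which the mode oscillates with frequency \<open>a\<close>
  gain a factor \<open>1 / a\<^sup>2\<close>.\<close>

lemma mode_coefficient_decay: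
  assumes E: "E \<in> smooth_torus" and \<phi>: "\<phi> \<in> smooth_torus" and b: "b \<in> Basis"
    and pd: "\<And>z. partial_deriv b E z = \<i> * of_int a * E z"
  shows "(of_int a)\<^sup>2 * cmod (integral torus_cell (\<lambda>z. E z * \<phi> z))
    \<le> integral torus_cell (\<lambda>z. cmod (E z)) * Ck_norm 2 \<phi>"
proof -
  let ?\<phi>1 = "partial_deriv b \<phi>" let ?\<phi>2 = "partial_deriv b ?\<phi>1"
  note \<phi>1 = smooth_torus_partial_deriv[OF \<phi> b]
  note \<phi>2 = smooth_torus_partial_deriv[OF \<phi>1 b]
  have "integral torus_cell (\<lambda>z. E z * ?\<phi>2 z)
      = (- \<i> * of_int a)\<^sup>2 * integral torus_cell (\<lambda>z. E z * \<phi> z)"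
    using integral_mode_partial_deriv[OF E \<phi>1 b pd] integral_mode_partial_deriv[OF E \<phi> b pd]
    by (simp add: power2_eq_square)
  then have "(of_int a)\<^sup>2 * cmod (integral torus_cell (\<lambda>z. E z * \<phi> z))
      = cmod (integral torus_cell (\<lambda>z. E z * ?\<phi>2 z))"
    by (simp add: norm_mult norm_power)
  also have "\<dots> \<le> integral torus_cell (\<lambda>z. cmod (E z) * Ck_norm 2 \<phi>)"
  proof (rule Henstock_Kurzweil_Integration.integral_norm_bound_integral)
    show "(\<lambda>z. E z * ?\<phi>2 z) integrable_on torus_cell"
      by (intro smooth_torus_integrable smooth_torus_mult E \<phi>2)
    show "(\<lambda>z. cmod (E z) * Ck_norm 2 \<phi>) integrable_on torus_cell"
      unfolding torus_cell_def
      by (intro integrable_continuous continuous_intros smooth_torus_continuous E)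
    show "cmod (E z * ?\<phi>2 z) \<le> cmod (E z) * Ck_norm 2 \<phi>" for z
      using partial_derivs_le_Ck_norm[OF \<phi>, of "[b, b]" 2 z] b
      by (simp add: norm_mult mult_left_mono)
  qed
  also have "\<dots> = integral torus_cell (\<lambda>z. cmod (E z)) * Ck_norm 2 \<phi>" by simp
  finally show ?thesis .
qed

text \<open>Moving the derivative in direction \<open>b\<close> from one factor to the other shows that the integral
  multiplied by \<open>a - a'\<close> vanishes.\<close>

lemma modes_orthogonal:
  assumes E: "E \<in> smooth_torus" and F: "F \<in> smooth_torus" and b: "b \<in> Basis"
    and pdE: "\<And>z. partial_deriv b E z = \<i> * of_int a * E z"
    and pdF: "\<And>z. partial_deriv b F z = \<i> * of_int a' * F z" and "a \<noteq> a'"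
  shows "integral torus_cell (\<lambda>z. E z * cnj (F z)) = 0"
proof -
  have "partial_deriv b (\<lambda>z. cnj (F z)) z = - \<i> * of_int a' * cnj (F z)" for z
    using partial_deriv_cnj[OF smooth_imp_differentiable[OF smooth_torusD(1)[OF F]]]
    by (simp add: pdF)
  then have "integral torus_cell (\<lambda>z. (- \<i> * of_int a') * (E z * cnj (F z)))
      = - \<i> * of_int a * integral torus_cell (\<lambda>z. E z * cnj (F z))"
    using integral_mode_partial_deriv[OF E smooth_torus_cnj[OF F] b pdE] by (simp add: mult_ac)
  with \<open>a \<noteq> a'\<close> show ?thesis by simp
qed

text \<open>Infinitely many modes that oscillate with distinct growing frequencies in one fixed direction
  \<open>b\<close> and are normalised in the \<open>L\<^sup>2\<close> norm. The condition on \<open>a\<close> makes \<open>\<Sum>k. 1 / (a k)\<^sup>2\<close> converge, so that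
  two derivatives of a test function control its pairing with the sum of all modes, whatever the
  dimension.\<close>

locale oscillating_modes =
  fixes E :: "nat \<Rightarrow> 'a::euclidean_space \<Rightarrow> complex" and b :: 'a and a :: "nat \<Rightarrow> int"
  assumes E: "\<And>k. E k \<in> smooth_torus" and b: "b \<in> Basis"
    and pd: "\<And>k z. partial_deriv b (E k) z = \<i> * of_int (a k) * E k z"
    and a: "\<And>k. int k < \<bar>a k\<bar>" and inj_a: "inj a"
    and normalised: "\<And>k. integral torus_cell (\<lambda>z. (cmod (E k z))\<^sup>2) = 1"
begin

definition L1_bound :: real where
  "L1_bound = integral torus_cell (\<lambda>_ :: 'a. 1) + 1"

text \<open>The \<open>L\<^sup>1\<close> norms are controlled by the \<open>L\<^sup>2\<close> norms because \<open>r \<le> 1 + r\<^sup>2\<close>.\<close>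

lemma integral_norm_mode_le: "integral torus_cell (\<lambda>z. cmod (E k z)) \<le> L1_bound"
proof -
  have *: "(\<lambda>z. cmod (E k z)) integrable_on torus_cell"
    "(\<lambda>z. (cmod (E k z))\<^sup>2) integrable_on torus_cell"
    "(\<lambda>_::'a. 1 :: real) integrable_on torus_cell"
    unfolding torus_cell_def
    by (intro integrable_continuous continuous_intros smooth_torus_continuous E)+
  have r: "r \<le> 1 + r\<^sup>2" for r :: real
    using zero_le_power2[of "r - 1 / 2"] by (simp add: power2_eq_square algebra_simps)
  have "integral torus_cell (\<lambda>z. cmod (E k z)) \<le> integral torus_cell (\<lambda>z. 1 + (cmod (E k z))\<^sup>2)"
    by (intro integral_le Henstock_Kurzweil_Integration.integrable_add * r)
  also have "\<dots> = integral torus_cell (\<lambda>_::'a. 1) + integral torus_cell (\<lambda>z. (cmod (E k z))\<^sup>2)"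
    by (intro Henstock_Kurzweil_Integration.integral_add *)
  finally show ?thesis unfolding L1_bound_def normalised .
qed

lemma coefficient_bound:
  assumes \<phi>: "\<phi> \<in> smooth_torus"
  shows "cmod (integral torus_cell (\<lambda>z. E k z * \<phi> z))
    \<le> L1_bound * Ck_norm 2 \<phi> * inverse ((real (Suc k))\<^sup>2)"
proof -
  have "(real (Suc k))\<^sup>2 \<le> (of_int \<bar>a k\<bar>)\<^sup>2"
    using a[of k] by (intro power_mono) auto
  then have "(real (Suc k))\<^sup>2 * cmod (integral torus_cell (\<lambda>z. E k z * \<phi> z))
      \<le> (of_int (a k))\<^sup>2 * cmod (integral torus_cell (\<lambda>z. E k z * \<phi> z))"
    by (intro mult_right_mono) auto
  also have "\<dots> \<le> integral torus_cell (\<lambda>z. cmod (E k z)) * Ck_norm 2 \<phi>"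
    by (rule mode_coefficient_decay[OF E \<phi> b pd])
  also have "\<dots> \<le> L1_bound * Ck_norm 2 \<phi>"
    by (intro mult_right_mono integral_norm_mode_le Ck_norm_nonneg \<phi>)
  finally show ?thesis by (simp add: field_simps)
qed

lemma summable_inverse_squares: "(\<lambda>k. C * inverse ((real (Suc k))\<^sup>2)) summable_on UNIV"
proof -
  have "summable (\<lambda>k. inverse ((real k)\<^sup>2))"
    using inverse_power_summable[of 2, where 'a = real] by simp
  then have "summable (\<lambda>k. inverse ((real (Suc k))\<^sup>2))" by (subst summable_Suc_iff)
  then show ?thesis
    by (intro summable_on_cmult_right) (simp add: summable_on_UNIV_nonneg_real_iff)
qed

lemma coefficients_abs_summable:
  assumes "\<phi> \<in> smooth_torus"
  shows "(\<lambda>k. cmod (integral torus_cell (\<lambda>z. E k z * \<phi> z))) summable_on UNIV"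
  by (rule summable_on_comparison_test[OF summable_inverse_squares])
    (use coefficient_bound[OF assms] in auto)

lemma mode_sum_distribution: "mode_sum E \<in> distributions"
  unfolding distributions_def
proof (intro CollectI conjI ballI allI)
  fix \<phi> \<psi> :: "'a \<Rightarrow> complex" assume *: "\<phi> \<in> smooth_torus" "\<psi> \<in> smooth_torus"
  have "integral torus_cell (\<lambda>z. E k z * (\<phi> z + \<psi> z))
      = integral torus_cell (\<lambda>z. E k z * \<phi> z) + integral torus_cell (\<lambda>z. E k z * \<psi> z)" for k
    unfolding distrib_left
    by (intro Henstock_Kurzweil_Integration.integral_add smooth_torus_integrable smooth_torus_mult E *)
  then show "mode_sum E (\<lambda>z. \<phi> z + \<psi> z) = mode_sum E \<phi> + mode_sum E \<psi>"
    unfolding mode_sum_def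
    by (simp add: infsum_add abs_summable_summable coefficients_abs_summable *)
next
  fix c :: complex and \<phi> :: "'a \<Rightarrow> complex"
  show "mode_sum E (\<lambda>z. c * \<phi> z) = c * mode_sum E \<phi>"
    unfolding mode_sum_def by (simp add: mult.left_commute[of _ c] infsum_cmult_right')
next
  let ?S = "\<Sum>\<^sub>\<infinity>k. inverse ((real (Suc k))\<^sup>2)"
  show "\<exists>C k. \<forall>\<phi>\<in>smooth_torus. cmod (mode_sum E \<phi>) \<le> C * Ck_norm k \<phi>"
  proof (intro exI ballI)
    fix \<phi> :: "'a \<Rightarrow> complex" assume \<phi>: "\<phi> \<in> smooth_torus"
    have "cmod (mode_sum E \<phi>) \<le> (\<Sum>\<^sub>\<infinity>k. cmod (integral torus_cell (\<lambda>z. E k z * \<phi> z)))"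
      unfolding mode_sum_def by (intro norm_infsum_bound coefficients_abs_summable \<phi>)
    also have "\<dots> \<le> (\<Sum>\<^sub>\<infinity>k. L1_bound * Ck_norm 2 \<phi> * inverse ((real (Suc k))\<^sup>2))"
      by (intro infsum_mono coefficients_abs_summable \<phi> summable_inverse_squares coefficient_bound)
    also have "\<dots> = L1_bound * ?S * Ck_norm 2 \<phi>"
      by (simp add: infsum_cmult_right' mult_ac)
    finally show "cmod (mode_sum E \<phi>) \<le> (L1_bound * ?S) * Ck_norm 2 \<phi>" .
  qed
qed

lemma mode_sum_cnj: "mode_sum E (\<lambda>z. cnj (E k z)) = 1"
proof -
  have "integral torus_cell (\<lambda>z. E l z * cnj (E k z)) = (if l = k then 1 else 0)" for l
  proof (cases "l = k")
    case True
    have "integral torus_cell (\<lambda>z. E k z * cnj (E k z))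
        = integral torus_cell (\<lambda>z. complex_of_real ((cmod (E k z))\<^sup>2))"
      by (simp only: complex_norm_square)
    also have "\<dots> = of_real (integral torus_cell (\<lambda>z. (cmod (E k z))\<^sup>2))"
      unfolding torus_cell_def
      by (rule integral_linear[OF integrable_continuous bounded_linear_of_real, unfolded o_def])
        (intro continuous_intros smooth_torus_continuous E)
    finally show ?thesis using True by (simp add: normalised)
  next
    case False
    then have "a l \<noteq> a k" using inj_a by (simp add: inj_eq)
    with False show ?thesis using modes_orthogonal[OF E E b pd pd] by simp
  qed
  then have "mode_sum E (\<lambda>z. cnj (E k z)) = (\<Sum>\<^sub>\<infinity>l. if l = k then 1 else 0)"
    unfolding mode_sum_def by simp
  also have "\<dots> = (\<Sum>\<^sub>\<infinity>l\<in>{k}. 1)"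
    by (intro infsum_cong_neutral) auto
  finally show ?thesis by simp
qed

text \<open>The coefficients of the sum with respect to the orthonormal modes are all equal to \<open>1\<close>, whereas
  those of a smooth function decay.\<close>

lemma mode_sum_not_smooth: "\<not> is_smooth_distribution (mode_sum E)"
proof
  assume "is_smooth_distribution (mode_sum E)"
  then obtain f where f: "f \<in> smooth_torus"
    and eq: "\<And>\<phi>. \<phi> \<in> smooth_torus \<Longrightarrow> mode_sum E \<phi> = integral torus_cell (\<lambda>z. f z * \<phi> z)"
    unfolding is_smooth_distribution_def by blast
  note cf = smooth_torus_cnj[OF f]
  have "1 \<le> L1_bound * Ck_norm 2 (\<lambda>z. cnj (f z)) * inverse ((real (Suc k))\<^sup>2)" for k
  proof -
    have "1 = cmod (integral torus_cell (\<lambda>z. f z * cnj (E k z)))"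
      using mode_sum_cnj[of k] eq[OF smooth_torus_cnj[OF E[of k]]] by simp
    also have "\<dots> = cmod (integral torus_cell (\<lambda>z. cnj (E k z * cnj (f z))))"
      by (simp add: mult.commute)
    also have "\<dots> = cmod (cnj (integral torus_cell (\<lambda>z. E k z * cnj (f z))))"
      using Henstock_Kurzweil_Integration.integral_cnj[of torus_cell "\<lambda>z. E k z * cnj (f z)"] by simp
    finally show ?thesis using coefficient_bound[OF cf, of k] by simp
  qed
  moreover have "(\<lambda>k. L1_bound * Ck_norm 2 (\<lambda>z. cnj (f z)) * inverse ((real (Suc k))\<^sup>2)) \<longlonglongrightarrow> 0"
    by (rule summable_LIMSEQ_zero) (rule summable_on_imp_summable[OF summable_inverse_squares])
  ultimately have "(1::real) \<le> 0"
    by (intro LIMSEQ_le_const) auto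
  then show False by simp
qed

end

section \<open>The operators of the system on a sum of modes\<close>

lemma torus_cell_prod:
  "(torus_cell :: ('a::euclidean_space \<times> 'b::euclidean_space) set)
    = cbox (0, 0) ((2 * pi) *\<^sub>R One, (2 * pi) *\<^sub>R One)"
  unfolding set_eq_iff mem_torus_cell mem_box
  by (auto simp: Basis_prod_def inner_One ball_Un)

lemma integral_torus_prod:
  fixes f :: "'a::euclidean_space \<times> 'b::euclidean_space \<Rightarrow> complex"
  assumes "continuous_on torus_cell f"
  shows "integral torus_cell f = integral torus_cell (\<lambda>t. integral torus_cell (\<lambda>x. f (t, x)))"
  using integral_prod_continuous[of 0 0 "(2 * pi) *\<^sub>R One" "(2 * pi) *\<^sub>R One" f] assms
  by (simp add: torus_cell_prod) (simp add: torus_cell_def)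

lemma real_vec_simps:
  "real_vec 0 = 0" "real_vec (\<xi> - \<eta>) = real_vec \<xi> - real_vec \<eta>"
  by (simp_all add: real_vec_def vec_eq_iff)

lemma has_derivative_cexp:
  fixes f :: "'a::real_normed_vector \<Rightarrow> complex"
  assumes "(f has_derivative f') (at x)"
  shows "((\<lambda>x. exp (f x)) has_derivative (\<lambda>h. f' h * exp (f x))) (at x)"
  using has_derivative_compose[OF assms DERIV_exp[unfolded has_field_derivative_def]]
  by (simp add: mult.commute)

lemma character_has_derivative:
  "((\<lambda>x. cis (x \<bullet> v)) has_derivative (\<lambda>h. \<i> * of_real (h \<bullet> v) * cis (x \<bullet> v))) (at x)"
  unfolding cis_conv_exp
  by (rule has_derivative_cexp) (auto intro!: derivative_eq_intros bounded_linear.has_derivative[OF bounded_linear_of_real])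

lemma character_smooth: "smooth (\<lambda>x :: 'a::euclidean_space. cis (x \<bullet> v))"
proof (rule smooth_log_derivative)
  show "(\<lambda>x. cis (x \<bullet> v)) differentiable at x" for x :: 'a
    unfolding differentiable_def using character_has_derivative by blast
  show "partial_deriv b (\<lambda>x. cis (x \<bullet> v)) x = (\<i> * of_real (b \<bullet> v)) * cis (x \<bullet> v)" for b x :: 'a
    by (rule partial_deriv_eqI) (rule character_has_derivative)
qed (rule smooth_const)

lemma cis_int_period: "cis (r + 2 * pi * of_int k) = cis r"
  by (simp add: cis_mult[symmetric] cis_multiple_2pi)

lemma character_smooth_torus: "(\<lambda>x. cis (x \<bullet> real_vec \<xi>)) \<in> smooth_torus"
  unfolding smooth_torus_def
  by (auto simp: character_smooth Basis_vec_def inner_add_left inner_axis' real_vec_def cis_int_period)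

lemma integral_character:
  fixes \<zeta> :: "int ^ 'N"
  shows "integral torus_cell (\<lambda>x. cis (x \<bullet> real_vec \<zeta>))
    = (if \<zeta> = 0 then complex_of_real ((2 * pi) ^ CARD('N)) else 0)"
proof (cases "\<zeta> = 0")
  case True
  have "measure lborel (torus_cell :: (real ^ 'N) set) = (2 * pi) ^ CARD('N)"
    unfolding torus_cell_def by (subst content_cbox) (auto simp: inner_One)
  with True show ?thesis
    by (simp add: real_vec_simps) (simp add: torus_cell_def scaleR_conv_of_real)
next
  case False
  then obtain i where i: "\<zeta> $ i \<noteq> 0" by (auto simp: vec_eq_iff)
  let ?b = "axis i 1 :: real ^ 'N"
  have b: "?b \<in> Basis" by (simp add: axis_in_Basis_iff)
  have "partial_deriv ?b (\<lambda>x. cis (x \<bullet> real_vec \<zeta>)) = (\<lambda>x. (\<i> * of_int (\<zeta> $ i)) * cis (x \<bullet> real_vec \<zeta>))"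
    by (rule ext, rule partial_deriv_eqI[OF character_has_derivative, THEN trans])
      (simp add: inner_axis' real_vec_def)
  then have "\<i> * of_int (\<zeta> $ i) * integral torus_cell (\<lambda>x. cis (x \<bullet> real_vec \<zeta>)) = 0"
    using integral_partial_deriv_zero[OF character_smooth_torus[of \<zeta>] b] by simp
  with i False show ?thesis by simp
qed

text \<open>By the orthogonality of the characters in \<open>x\<close>, pairing with a single character selects one mode.\<close>

lemma mode_sum_tensor:
  fixes w :: "nat \<Rightarrow> real ^ 'n \<Rightarrow> complex" and \<xi> :: "nat \<Rightarrow> int ^ 'N"
  assumes E: "\<And>k t x. E k (t, x) = w k t * cis (x \<bullet> real_vec (\<xi> k))"
    and w: "\<And>k. continuous_on UNIV (w k)" and \<psi>: "continuous_on UNIV \<psi>" and "inj \<xi>"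
  shows "mode_sum E (\<lambda>(t, x). \<psi> t * cis (- (x \<bullet> real_vec (\<xi> k))))
      = of_real ((2 * pi) ^ CARD('N)) * integral torus_cell (\<lambda>t. w k t * \<psi> t)"
    and "\<eta> \<notin> range \<xi> \<Longrightarrow> mode_sum E (\<lambda>(t, x). \<psi> t * cis (- (x \<bullet> real_vec \<eta>))) = 0"
proof -
  have coeff: "integral torus_cell (\<lambda>z. E k z * (case z of (t, x) \<Rightarrow> \<psi> t * cis (- (x \<bullet> real_vec \<eta>))))
      = (if \<xi> k = \<eta> then of_real ((2 * pi) ^ CARD('N)) * integral torus_cell (\<lambda>t. w k t * \<psi> t) else 0)"
    (is "?l = ?r") for k \<eta>
  proof -
    have 1: "E k z * (case z of (t, x) \<Rightarrow> \<psi> t * cis (- (x \<bullet> real_vec \<eta>)))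
        = w k (fst z) * \<psi> (fst z) * cis (snd z \<bullet> real_vec (\<xi> k - \<eta>))" for z
      by (cases z) (simp add: E real_vec_simps inner_diff_right cis_mult)
    have "?l = integral torus_cell (\<lambda>t. integral torus_cell (\<lambda>x.
        w k t * \<psi> t * cis (x \<bullet> real_vec (\<xi> k - \<eta>))))"
      unfolding 1
      by (subst integral_torus_prod)
        (auto intro!: continuous_intros continuous_on_compose2[OF w] continuous_on_compose2[OF \<psi>]
          continuous_on_compose2[OF smooth_torus_continuous[OF character_smooth_torus, of UNIV]])
    also have "\<dots> = ?r"
      by (simp add: integral_character mult.commute)
    finally show ?thesis .
  qed
  show "mode_sum E (\<lambda>(t, x). \<psi> t * cis (- (x \<bullet> real_vec (\<xi> k))))
      = of_real ((2 * pi) ^ CARD('N)) * integral torus_cell (\<lambda>t. w k t * \<psi> t)" (is "_ = ?R")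
  proof -
    have "mode_sum E (\<lambda>(t, x). \<psi> t * cis (- (x \<bullet> real_vec (\<xi> k)))) = (\<Sum>\<^sub>\<infinity>l\<in>{k}. ?R)"
      unfolding mode_sum_def coeff using \<open>inj \<xi>\<close>
      by (intro infsum_cong_neutral) (auto simp: inj_eq)
    then show ?thesis by simp
  qed
  show "mode_sum E (\<lambda>(t, x). \<psi> t * cis (- (x \<bullet> real_vec \<eta>))) = 0" if "\<eta> \<notin> range \<xi>"
    unfolding mode_sum_def coeff using that by (intro infsum_0) auto
qed

text \<open>Each partial Fourier coefficient of the sum is either a single mode or zero, so the series over the
  lattice that defines the operator has the same nonzero terms as the series on the right; the two
  sums agree, be they convergent or not.\<close>

lemma psd_op_mode_sum:
  fixes w :: "nat \<Rightarrow> real ^ 'n \<Rightarrow> complex" and \<xi> :: "nat \<Rightarrow> int ^ 'N"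
  assumes E: "\<And>k t x. E k (t, x) = w k t * cis (x \<bullet> real_vec (\<xi> k))"
    and w: "\<And>k. continuous_on UNIV (w k)" and \<phi>: "continuous_on UNIV \<phi>" and inj: "inj \<xi>"
  shows "psd_op p (mode_sum E) \<phi> = (\<Sum>\<^sub>\<infinity>k. p (\<xi> k) * integral torus_cell (\<lambda>z. E k z * \<phi> z))"
proof -
  define \<psi> where "\<psi> \<eta> t = integral torus_cell (\<lambda>x. cis (x \<bullet> real_vec \<eta>) * \<phi> (t, x))" for \<eta> :: "int ^ 'N" and t
  have \<psi>: "continuous_on UNIV (\<psi> \<eta>)" for \<eta>
    unfolding \<psi>_def torus_cell_def
    by (rule integral_continuous_on_param)
      (auto simp: split_beta intro!: continuous_intros continuous_on_compose2[OF \<phi>]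
        continuous_on_compose2[OF smooth_torus_continuous[OF character_smooth_torus, of UNIV]])
  note tensor = mode_sum_tensor[OF E w \<psi> inj]
  have on: "fourier_coeff_x (mode_sum E) (\<xi> k) (\<psi> (\<xi> k)) = integral torus_cell (\<lambda>z. E k z * \<phi> z)" for k
  proof -
    have "fourier_coeff_x (mode_sum E) (\<xi> k) (\<psi> (\<xi> k)) = integral torus_cell (\<lambda>t. w k t * \<psi> (\<xi> k) t)"
      unfolding fourier_coeff_x_def tensor(1) by simp
    also have "\<dots> = integral torus_cell (\<lambda>t. integral torus_cell (\<lambda>x. E k (t, x) * \<phi> (t, x)))"
      unfolding \<psi>_def E mult.assoc by simp
    also have "\<dots> = integral torus_cell (\<lambda>z. E k z * \<phi> z)"
    proof (rule integral_torus_prod[symmetric])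
      have "E k = (\<lambda>z. w k (fst z) * cis (snd z \<bullet> real_vec (\<xi> k)))"
        by (auto simp: fun_eq_iff E)
      then show "continuous_on torus_cell (\<lambda>z. E k z * \<phi> z)"
        by (auto intro!: continuous_intros continuous_on_compose2[OF w] continuous_on_subset[OF \<phi>]
            continuous_on_compose2[OF smooth_torus_continuous[OF character_smooth_torus, of UNIV]])
    qed
    finally show ?thesis .
  qed
  have off: "fourier_coeff_x (mode_sum E) \<eta> (\<psi> \<eta>) = 0" if "\<eta> \<notin> range \<xi>" for \<eta>
    unfolding fourier_coeff_x_def tensor(2)[OF that] by simp
  have "psd_op p (mode_sum E) \<phi> = (\<Sum>\<^sub>\<infinity>\<eta>. p \<eta> * fourier_coeff_x (mode_sum E) \<eta> (\<psi> \<eta>))"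
    unfolding psd_op_def \<psi>_def ..
  also have "\<dots> = (\<Sum>\<^sub>\<infinity>\<eta>\<in>range \<xi>. p \<eta> * fourier_coeff_x (mode_sum E) \<eta> (\<psi> \<eta>))"
    by (intro infsum_cong_neutral) (auto simp: off)
  also have "\<dots> = (\<Sum>\<^sub>\<infinity>k. p (\<xi> k) * integral torus_cell (\<lambda>z. E k z * \<phi> z))"
    by (subst infsum_reindex[OF inj]) (simp add: o_def on)
  finally show ?thesis .
qed

text \<open>Integration by parts moves \<open>D\<^bsub>t\<^sub>j\<^esub>\<close> from the test function to the modes, where it acts as
  multiplication by \<open>- c\<^sub>j(t\<^sub>j) p\<^sub>j(\<xi>)\<close>. The two parts of the operator therefore give opposite series with
  the same terms, which cancel even without convergence.\<close>

lemma system_op_mode_sum_zero: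
  fixes w :: "nat \<Rightarrow> real ^ 'n \<Rightarrow> complex" and \<xi> :: "nat \<Rightarrow> int ^ 'N"
  assumes E: "\<And>k t x. E k (t, x) = w k t * cis (x \<bullet> real_vec (\<xi> k))"
    and w: "\<And>k. continuous_on UNIV (w k)" and inj: "inj \<xi>"
    and smooth: "\<And>k. E k \<in> smooth_torus" and c: "continuous_on UNIV (c j)"
    and pd: "\<And>k z. partial_deriv (axis j 1, 0) (E k) z = - \<i> * (p j (\<xi> k) * c j (fst z $ j)) * E k z"
    and \<phi>: "\<phi> \<in> smooth_torus"
  shows "system_op c p j (mode_sum E) \<phi> = 0"
proof -
  let ?b = "(axis j 1, 0) :: (real ^ 'n) \<times> (real ^ 'N)"
  let ?g = "\<lambda>z :: (real ^ 'n) \<times> (real ^ 'N). c j (fst z $ j) * \<phi> z"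
  have b: "?b \<in> Basis" by (auto simp: Basis_prod_def axis_in_Basis_iff)
  have coeff: "integral torus_cell (\<lambda>z. E k z * (inverse \<i> * partial_deriv ?b \<phi> z))
      = p j (\<xi> k) * integral torus_cell (\<lambda>z. E k z * ?g z)" for k
  proof -
    have "integral torus_cell (\<lambda>z. E k z * (inverse \<i> * partial_deriv ?b \<phi> z))
        = inverse \<i> * integral torus_cell (\<lambda>z. E k z * partial_deriv ?b \<phi> z)"
      by (simp only: mult.left_commute[of _ "inverse \<i>"] Henstock_Kurzweil_Integration.integral_mult_right)
    also have "\<dots> = - inverse \<i> * integral torus_cell (\<lambda>z. partial_deriv ?b (E k) z * \<phi> z)"
      using integral_torus_by_parts[OF smooth \<phi> b] by simp
    also have "(\<lambda>z. partial_deriv ?b (E k) z * \<phi> z) = (\<lambda>z. (- \<i> * p j (\<xi> k)) * (E k z * ?g z))"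
      by (simp add: pd fun_eq_iff mult_ac)
    also have "- inverse \<i> * integral torus_cell (\<lambda>z. (- \<i> * p j (\<xi> k)) * (E k z * ?g z))
        = (- inverse \<i> * (- \<i> * p j (\<xi> k))) * integral torus_cell (\<lambda>z. E k z * ?g z)"
      unfolding Henstock_Kurzweil_Integration.integral_mult_right by (rule mult.assoc[symmetric])
    also have "- inverse \<i> * (- \<i> * p j (\<xi> k)) = p j (\<xi> k)"
      by (simp add: complex_eq_iff)
    finally show ?thesis .
  qed
  have "continuous_on UNIV ?g"
    by (intro continuous_intros continuous_on_compose2[OF c] smooth_torus_continuous \<phi>) auto
  note psd = psd_op_mode_sum[OF E w this inj]
  have "D_op ?b (mode_sum E) \<phi> = - (\<Sum>\<^sub>\<infinity>k. p j (\<xi> k) * integral torus_cell (\<lambda>z. E k z * ?g z))"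
    unfolding D_op_def by (simp only: mode_sum_def coeff)
  moreover have "mult_op (\<lambda>(t, x). c j (t $ j)) (psd_op (p j) (mode_sum E)) \<phi>
      = (\<Sum>\<^sub>\<infinity>k. p j (\<xi> k) * integral torus_cell (\<lambda>z. E k z * ?g z))"
    unfolding mult_op_def split_beta by (rule psd)
  ultimately show ?thesis unfolding system_op_def by simp
qed

section \<open>Solutions of the homogeneous system\<close>

text \<open>The increment of a primitive over one period does not depend on the starting point, because
  its derivative vanishes by periodicity; starting at \<open>0\<close> it is the integral that defines the mean.\<close>

lemma primitive_of_periodic:
  assumes "g \<in> smooth_torus"
  obtains G :: "real \<Rightarrow> complex" where "\<And>s. (G has_vector_derivative g s) (at s)"
    "\<And>s. G (s + 2 * pi) = G s + 2 * pi * mean_value g"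
proof -
  have cont: "isCont g s" for s
    using smooth_torus_continuous[OF assms, of UNIV] by (simp add: continuous_on_eq_continuous_at)
  obtain G where G: "\<And>s. (G has_vector_derivative g s) (at s)"
    using einterval_antiderivative[of "-\<infinity>" "\<infinity>" g] cont by auto
  have shift: "((\<lambda>s. G (s + 2 * pi)) has_vector_derivative g s) (at s)" for s
  proof -
    have "(G \<circ> (\<lambda>s. s + 2 * pi) has_vector_derivative 1 *\<^sub>R g (s + 2 * pi)) (at s)"
      by (rule vector_diff_chain_at) (auto intro!: derivative_eq_intros G)
    then show ?thesis
      using smooth_torusD(2)[OF assms, of 1 s] by (simp add: o_def)
  qed
  have "((\<lambda>s. G (s + 2 * pi) - G s) has_vector_derivative 0) (at s within UNIV)" for s
    using has_vector_derivative_diff[OF shift G, of s] by simp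
  then obtain K where K: "\<And>s. G (s + 2 * pi) - G s = K"
    using has_vector_derivative_zero_constant[of UNIV "\<lambda>s. G (s + 2 * pi) - G s"] by auto
  have "(g has_integral G (2 * pi) - G 0) {0..2 * pi}"
    by (rule fundamental_theorem_of_calculus) (auto intro: has_vector_derivative_at_within G)
  then have "K = 2 * pi * mean_value g"
    using K[of 0] by (simp add: mean_value_def integral_unique)
  with K G show ?thesis by (intro that[of G]) (auto simp: algebra_simps)
qed

text \<open>The system separates variables: \<open>exp (- \<i> \<Sum>j. p\<^sub>j(\<xi>) C\<^sub>j(t\<^sub>j)) cis (x \<bullet> \<xi>)\<close> with \<open>C\<^sub>j' = c\<^sub>j\<close> is annihilated by
  all operators of the system. Over a period of \<open>t\<^sub>j\<close> it is multiplied by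
  \<open>exp (- 2\<pi>\<i> c\<^sub>j\<^sub>0 p\<^sub>j(\<xi>))\<close>, so integrality of \<open>c\<^sub>j\<^sub>0 p\<^sub>j(\<xi>)\<close> makes it periodic. Since it has no zeros, it
  can be normalised in \<open>L\<^sup>2\<close>. The number \<open>q j\<close> stands for \<open>p\<^sub>j(\<xi>)\<close>.\<close>

lemma homogeneous_solution:
  fixes c :: "'n::finite \<Rightarrow> real \<Rightarrow> complex" and q :: "'n \<Rightarrow> complex" and \<xi> :: "int ^ 'N"
  assumes c: "\<And>j. c j \<in> smooth_torus" and q: "\<And>j. mean_value (c j) * q j \<in> \<int>"
  obtains E :: "(real ^ 'n) \<times> (real ^ 'N) \<Rightarrow> complex" and w :: "real ^ 'n \<Rightarrow> complex"
  where "E \<in> smooth_torus" "\<And>t x. E (t, x) = w t * cis (x \<bullet> real_vec \<xi>)"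
    "continuous_on UNIV w"
    "\<And>j z. partial_deriv (axis j 1, 0) E z = - \<i> * (q j * c j (fst z $ j)) * E z"
    "\<And>i z. partial_deriv (0, axis i 1) E z = \<i> * of_int (\<xi> $ i) * E z"
    "integral torus_cell (\<lambda>z. (cmod (E z))\<^sup>2) = 1"
proof -
  have "\<exists>G. (\<forall>s. (G has_vector_derivative c j s) (at s)) \<and>
      (\<forall>s. G (s + 2 * pi) = G s + 2 * pi * mean_value (c j))" for j
    by (rule primitive_of_periodic[OF c[of j]]) blast
  then obtain C where C: "\<And>j s. (C j has_vector_derivative c j s) (at s)"
    and C_shift: "\<And>j s. C j (s + 2 * pi) = C j s + 2 * pi * mean_value (c j)"
    by metis
  define w0 where "w0 t = exp (- \<i> * (\<Sum>j\<in>UNIV. q j * C j (t $ j)))" for t :: "real ^ 'n"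
  define E0 where "E0 z = w0 (fst z) * cis (snd z \<bullet> real_vec \<xi>)" for z :: "(real ^ 'n) \<times> (real ^ 'N)"
  \<comment> \<open>The derivative in direction \<open>b\<close> of the exponent of \<open>E0\<close>; coordinates of \<open>t\<close> are written as inner
    products so that its smoothness follows from that of functions of one coordinate.\<close>
  define g where "g b z = - \<i> * (\<Sum>j\<in>UNIV. (q j * of_real (fst b $ j)) * c j (z \<bullet> (axis j 1, 0)))
      + \<i> * of_real (snd b \<bullet> real_vec \<xi>)" for b z :: "(real ^ 'n) \<times> (real ^ 'N)"
  have C_der: "((\<lambda>z :: (real ^ 'n) \<times> (real ^ 'N). C j (fst z $ j)) has_derivative
      (\<lambda>h. of_real (fst h $ j) * c j (fst z $ j))) (at z)" for j z
  proof -
    have "((\<lambda>z :: (real ^ 'n) \<times> (real ^ 'N). fst z $ j) has_derivative (\<lambda>h. fst h $ j)) (at z)"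
      by (intro bounded_linear.has_derivative[OF bounded_linear_vec_nth] has_derivative_fst has_derivative_ident)
    from has_derivative_compose[OF this C[unfolded has_vector_derivative_def]]
    show ?thesis by (simp add: scaleR_conv_of_real)
  qed
  have E0_exp: "E0 = (\<lambda>z. exp (- \<i> * (\<Sum>j\<in>UNIV. q j * C j (fst z $ j)) + \<i> * of_real (snd z \<bullet> real_vec \<xi>)))"
    unfolding E0_def w0_def cis_conv_exp exp_add ..
  have E0_der: "(E0 has_derivative (\<lambda>b. g b z * E0 z)) (at z)" for z
  proof -
    have "((\<lambda>z. - \<i> * (\<Sum>j\<in>UNIV. q j * C j (fst z $ j)) + \<i> * of_real (snd z \<bullet> real_vec \<xi>)) has_derivative
        (\<lambda>b. - \<i> * (\<Sum>j\<in>UNIV. q j * (of_real (fst b $ j) * c j (fst z $ j)))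
          + \<i> * of_real (snd b \<bullet> real_vec \<xi>))) (at z)"
      by (intro has_derivative_add has_derivative_mult_right has_derivative_sum C_der
          has_derivative_of_real has_derivative_inner_left has_derivative_snd has_derivative_ident)
    moreover have "fst z $ j = z \<bullet> (axis j 1, 0)" for j
      by (simp add: inner_prod_def inner_axis)
    ultimately show ?thesis
      using has_derivative_cexp unfolding E0_exp g_def mult.assoc by fastforce
  qed
  have g: "smooth (g b)" for b
    unfolding g_def
    by (intro smooth_add smooth_mult smooth_sum smooth_const smooth_coordinate smooth_torusD(1)[OF c])
  have w0_per: "w0 (t + (2 * pi) *\<^sub>R axis j 1) = w0 t" for t j
  proof -
    obtain k where k: "mean_value (c j) * q j = of_int k" using q[of j] by (auto elim: Ints_cases)
    have "q j * mean_value (c j) = of_int k" using k by (simp only: mult.commute)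
    moreover have "q j * C j (s + 2 * pi) = q j * C j s + of_real (2 * pi) * (q j * mean_value (c j))" for s
      unfolding C_shift by (simp add: algebra_simps)
    ultimately have k_shift: "q j * C j (s + 2 * pi) = q j * C j s + of_real (2 * pi) * of_int k" for s
      by simp
    have "q i * C i ((t + (2 * pi) *\<^sub>R axis j 1) $ i)
        = q i * C i (t $ i) + (if i = j then of_real (2 * pi) * of_int k else 0)" for i
      using k_shift[of "t $ j"] by (auto simp: axis_def)
    then have "w0 (t + (2 * pi) *\<^sub>R axis j 1) = exp (- \<i> * (\<Sum>i\<in>UNIV. q i * C i (t $ i))
        + 2 * of_int (- k) * of_real pi * \<i>)"
      unfolding w0_def by (simp add: sum.distrib algebra_simps)
    also have "\<dots> = w0 t * exp (2 * of_int (- k) * of_real pi * \<i>)"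
      unfolding w0_def by (rule exp_add)
    also have "exp (2 * of_int (- k) * of_real pi * \<i>) = 1"
      using exp_integer_2pi[of "of_int (- k)"] by (simp add: mult_ac)
    finally show ?thesis by simp
  qed
  have character_per: "cis ((x + (2 * pi) *\<^sub>R axis i 1) \<bullet> real_vec \<xi>) = cis (x \<bullet> real_vec \<xi>)" for x i
    using smooth_torusD(2)[OF character_smooth_torus[of \<xi>], of "axis i 1" x]
    by (simp add: axis_in_Basis_iff)
  have "E0 (z + (2 * pi) *\<^sub>R b) = E0 z" if "b \<in> Basis" for b z
    using that w0_per character_per
    by (auto simp: Basis_prod_def E0_def Basis_vec_def)
  moreover have "smooth E0"
  proof (rule smooth_log_derivative[OF _ g])
    show "E0 differentiable at z" for z using E0_der unfolding differentiable_def by blast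
  qed (rule partial_deriv_eqI, rule E0_der)
  ultimately have E0: "E0 \<in> smooth_torus" by (auto simp: smooth_torus_def)
  have C_cont: "continuous_on UNIV (C j)" for j
    using C by (meson continuous_at_imp_continuous_on has_vector_derivative_continuous)
  have w0: "continuous_on UNIV w0"
    unfolding w0_def by (intro continuous_intros continuous_on_compose2[OF C_cont]) auto
  let ?I = "integral torus_cell (\<lambda>z. (cmod (E0 z))\<^sup>2)"
  have cont: "continuous_on S (\<lambda>z. (cmod (E0 z))\<^sup>2)" for S
    by (intro continuous_intros smooth_torus_continuous E0)
  have "0 \<le> ?I"
    unfolding torus_cell_def by (intro Henstock_Kurzweil_Integration.integral_nonneg integrable_continuous cont) auto
  moreover have "?I \<noteq> 0"
  proof
    assume "?I = 0"
    moreover have "box 0 ((2 * pi) *\<^sub>R One) \<noteq> ({} :: ((real ^ 'n) \<times> (real ^ 'N)) set)"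
      unfolding box_ne_empty by (simp add: inner_One)
    ultimately have "\<forall>z\<in>torus_cell. (cmod (E0 z))\<^sup>2 = 0"
      unfolding torus_cell_def by (simp add: integral_cbox_eq_0_iff[OF cont])
    moreover have "0 \<in> (torus_cell :: ((real ^ 'n) \<times> (real ^ 'N)) set)"
      by (simp add: mem_torus_cell)
    ultimately have "(cmod (E0 0))\<^sup>2 = 0" by blast
    then show False by (simp add: E0_def w0_def)
  qed
  ultimately have I: "?I > 0" by simp
  define K where "K = complex_of_real (1 / sqrt ?I)"
  show ?thesis
  proof (rule that[of "\<lambda>z. K * E0 z" "\<lambda>t. K * w0 t"])
    show "(\<lambda>z. K * E0 z) \<in> smooth_torus" by (intro smooth_torus_mult smooth_torus_const E0)
    show "K * E0 (t, x) = K * w0 t * cis (x \<bullet> real_vec \<xi>)" for t x by (simp add: E0_def)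
    show "continuous_on UNIV (\<lambda>t. K * w0 t)" by (intro continuous_intros w0)
    have pd: "partial_deriv b (\<lambda>z. K * E0 z) z = K * (g b z * E0 z)" for b z
      by (rule partial_deriv_eqI) (intro has_derivative_mult_right E0_der)
    show "partial_deriv (axis j 1, 0) (\<lambda>z. K * E0 z) z = - \<i> * (q j * c j (fst z $ j)) * (K * E0 z)" for j z
    proof -
      have "(\<Sum>i\<in>UNIV. q i * complex_of_real ((axis j 1 :: real ^ 'n) $ i) * c i (fst z $ i))
          = (\<Sum>i\<in>UNIV. if i = j then q j * c j (fst z $ j) else 0)"
        by (rule sum.cong) (auto simp: axis_def)
      then show ?thesis unfolding pd by (simp add: g_def inner_axis inner_prod_def)
    qed
    show "partial_deriv (0, axis i 1) (\<lambda>z. K * E0 z) z = \<i> * of_int (\<xi> $ i) * (K * E0 z)" for i z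
      unfolding pd by (simp add: g_def inner_axis' real_vec_def)
    have "(cmod (K * E0 z))\<^sup>2 = (1 / ?I) * (cmod (E0 z))\<^sup>2" for z
      using I by (simp add: K_def norm_mult norm_divide power_mult_distrib power_divide)
    then show "integral torus_cell (\<lambda>z. (cmod (K * E0 z))\<^sup>2) = 1"
      using I by simp
  qed
qed

section \<open>Finiteness of the resonant frequencies\<close>

text \<open>If each coordinate took only finitely many values on \<open>Z\<close>, then \<open>Z\<close> would be finite; a coordinate
  with infinitely many values yields a sequence along which it is strictly increasing in absolute
  value. Growth in one fixed coordinate suffices to sum over the sequence and to separate its
  members by integrating by parts in a single variable.\<close>

lemma infinite_lattice_coordinate_sequence:
  fixes Z :: "(int ^ 'N) set"
  assumes "infinite Z"
  obtains \<xi> :: "nat \<Rightarrow> int ^ 'N" and i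
  where "range \<xi> \<subseteq> Z" "\<And>k. int k < \<bar>\<xi> k $ i\<bar>" "inj (\<lambda>k. \<xi> k $ i)"
proof -
  have "\<exists>i. infinite ((\<lambda>\<xi>. \<xi> $ i) ` Z)"
  proof (rule ccontr)
    assume "\<nexists>i. infinite ((\<lambda>\<xi>. \<xi> $ i) ` Z)"
    then have "finite (PiE UNIV (\<lambda>i. (\<lambda>\<xi>. \<xi> $ i) ` Z))"
      by (intro finite_PiE) auto
    moreover have "(\<lambda>\<xi> i. \<xi> $ i) ` Z \<subseteq> PiE UNIV (\<lambda>i. (\<lambda>\<xi>. \<xi> $ i) ` Z)" by auto
    ultimately have "finite ((\<lambda>\<xi> i. \<xi> $ i) ` Z)" by (rule rev_finite_subset)
    then have "finite Z"
      by (rule finite_imageD) (auto simp: inj_on_def vec_eq_iff fun_eq_iff)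
    with assms show False by contradiction
  qed
  then obtain i where i: "infinite ((\<lambda>\<xi>. \<xi> $ i) ` Z)" by blast
  let ?A = "(\<lambda>\<xi>. nat \<bar>\<xi> $ i\<bar>) ` Z"
  have "infinite ?A"
  proof
    assume "finite ?A"
    then obtain m where "\<And>\<xi>. \<xi> \<in> Z \<Longrightarrow> nat \<bar>\<xi> $ i\<bar> \<le> m" unfolding finite_nat_set_iff_bounded_le by auto
    then have "(\<lambda>\<xi>. \<xi> $ i) ` Z \<subseteq> {- int m..int m}" by fastforce
    with i show False using finite_subset by blast
  qed
  from infinite_enumerate[OF this]
  obtain r :: "nat \<Rightarrow> nat" where r: "strict_mono r" "\<And>k. r k \<in> ?A" by (elim exE conjE) simp
  have "\<forall>k. \<exists>\<xi>. \<xi> \<in> Z \<and> r k = nat \<bar>\<xi> $ i\<bar>" using r(2) by (simp add: image_iff Bex_def)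
  from choice[OF this] obtain \<eta> where "\<forall>k. \<eta> k \<in> Z \<and> r k = nat \<bar>\<eta> k $ i\<bar>" ..
  then have \<eta>: "\<And>k. \<eta> k \<in> Z" "\<And>k. r k = nat \<bar>\<eta> k $ i\<bar>" by simp_all
  \<comment> \<open>The index is shifted by one because \<open>r 0\<close> may vanish.\<close>
  show ?thesis
  proof
    show "range (\<lambda>k. \<eta> (Suc k)) \<subseteq> Z" using \<eta> by auto
    show "int k < \<bar>\<eta> (Suc k) $ i\<bar>" for k
      using seq_suble[OF r(1), of "Suc k"] \<eta>(2)[of "Suc k"] by linarith
    show "inj (\<lambda>k. \<eta> (Suc k) $ i)"
    proof (rule injI)
      fix k l assume "\<eta> (Suc k) $ i = \<eta> (Suc l) $ i"
      then have "r (Suc k) = r (Suc l)" using \<eta>(2) by simp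
      then show "k = l" using strict_mono_eq[OF r(1)] by simp
    qed
  qed
qed

theorem proposition3p3:
  fixes c :: "'n::finite \<Rightarrow> real \<Rightarrow> complex"
    and m :: "'n \<Rightarrow> real"
    and p :: "'n \<Rightarrow> int ^ 'N \<Rightarrow> complex"
  assumes "\<And>j. c j \<in> smooth_torus"
    and "\<And>j. p j \<in> toroidal_symbols (m j)"
    and "globally_hypoelliptic (system_op c p)"
  shows "finite (\<Inter>j. {\<xi>. mean_value (c j) * p j \<xi> \<in> \<int>})"
proof (rule ccontr)
  assume "infinite (\<Inter>j. {\<xi>. mean_value (c j) * p j \<xi> \<in> \<int>})"
  then obtain \<xi> :: "nat \<Rightarrow> int ^ 'N" and i
    where Z: "range \<xi> \<subseteq> (\<Inter>j. {\<xi>. mean_value (c j) * p j \<xi> \<in> \<int>})"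
      and growth: "\<And>k. int k < \<bar>\<xi> k $ i\<bar>" and inj_i: "inj (\<lambda>k. \<xi> k $ i)"
    by (rule infinite_lattice_coordinate_sequence) (rule that; assumption)
  have "\<exists>E w. (E :: (real ^ 'n) \<times> (real ^ 'N) \<Rightarrow> complex) \<in> smooth_torus
      \<and> (\<forall>t x. E (t, x) = w t * cis (x \<bullet> real_vec (\<xi> k))) \<and> continuous_on UNIV w
      \<and> (\<forall>j z. partial_deriv (axis j 1, 0) E z = - \<i> * (p j (\<xi> k) * c j (fst z $ j)) * E z)
      \<and> (\<forall>i z. partial_deriv (0, axis i 1) E z = \<i> * of_int (\<xi> k $ i) * E z)
      \<and> integral torus_cell (\<lambda>z. (cmod (E z))\<^sup>2) = 1" for k
  proof -
    have "mean_value (c j) * p j (\<xi> k) \<in> \<int>" for j using Z by auto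
    then show ?thesis
      by (rule homogeneous_solution[where q = "\<lambda>j. p j (\<xi> k)" and \<xi> = "\<xi> k", OF assms(1)])
        (intro exI conjI allI)
  qed
  then obtain E :: "nat \<Rightarrow> (real ^ 'n) \<times> (real ^ 'N) \<Rightarrow> complex" and w
    where E_smooth: "\<And>k. E k \<in> smooth_torus"
      and E_eq: "\<And>k t x. E k (t, x) = w k t * cis (x \<bullet> real_vec (\<xi> k))"
      and w: "\<And>k. continuous_on UNIV (w k)"
      and pd_t: "\<And>k j z. partial_deriv (axis j 1, 0) (E k) z
          = - \<i> * (p j (\<xi> k) * c j (fst z $ j)) * E k z"
      and pd_x: "\<And>k i z. partial_deriv (0, axis i 1) (E k) z = \<i> * of_int (\<xi> k $ i) * E k z"
      and norm: "\<And>k. integral torus_cell (\<lambda>z. (cmod (E k z))\<^sup>2) = 1"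
    by metis
  interpret oscillating_modes E "(0, axis i 1)" "\<lambda>k. \<xi> k $ i"
    by unfold_locales (auto simp: E_smooth pd_x growth inj_i norm Basis_prod_def axis_in_Basis_iff)
  have "inj \<xi>" using inj_i by (auto simp: inj_def)
  then have "system_op c p j (mode_sum E) \<phi> = 0" if "\<phi> \<in> smooth_torus" for j \<phi>
    using that
    by (intro system_op_mode_sum_zero[where E = E and w = w and \<xi> = \<xi>, OF E_eq w _ E_smooth smooth_torus_continuous[OF assms(1)] pd_t])
  then have "is_smooth_distribution (system_op c p j (mode_sum E))" for j
    unfolding is_smooth_distribution_def by (intro bexI[of _ "\<lambda>_. 0"]) (auto simp: smooth_torus_const)
  with assms(3) mode_sum_distribution have "is_smooth_distribution (mode_sum E)"
    unfolding globally_hypoelliptic_def by blast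
  with mode_sum_not_smooth show False by contradiction
qed

end
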